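(* Let $n\geq 1$, $k\in\{0,\dots,n-1\}$, let $K\subseteq\mathbb{R}^n$ be an origin-symmetric convex body and let $L\subset\mathbb{R}^n$ be a $k$-dimensional linear lattice subspace, i.e., a $k$-dimensional linear subspace with $\dim(L\cap\mathbb{Z}^n)=k$. Then for any $\mathbf{t}\in\mathbb{R}^n$, $$\#(K\cap(\mathbf{t}+L))\leq 2^{k}\,\#(K\cap L).$$ Moreover, the inequality is best possible: for all $n\ge 1$ and $k\in\{0,\dots,n-1\}$, the constant $2^k$ cannot be replaced by a smaller constant (valid for all such $K$, $L$, $\mathbf{t}$).
   Context: A convex body in $\mathbb{R}^n$ is a compact convex set (not necessarily with non-empty interior); it is origin-symmetric if $K=-K$. For $M\subseteq\mathbb{R}^n$, $\#(M)=|M\cap\mathbb{Z}^n|$ is the number of integer points in $M$. For a linear subspace $L$, $\dim(L\cap\mathbb{Z}^n)$ is the dimension of the linear span of $L\cap\mathbb{Z}^n$. *)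

theory Defs
  imports "HOL-Analysis.Analysis"
begin

definition int_lattice :: "(real ^ 'n) set" where
  "int_lattice = {x. \<forall>i. x $ i \<in> \<int>}"

(* Only meaningful for sets with finitely many integer points, e.g. bounded sets:
   card of an infinite set is 0. *)
definition num_int_points :: "(real ^ 'n) set \<Rightarrow> nat" where
  "num_int_points M = card (M \<inter> int_lattice)"

(* The interior may be empty. *)
definition convex_body :: "(real ^ 'n) set \<Rightarrow> bool" where
  "convex_body K \<longleftrightarrow> compact K \<and> convex K"

definition origin_symmetric :: "(real ^ 'n) set \<Rightarrow> bool" where
  "origin_symmetric K \<longleftrightarrow> K = uminus ` K"

(* For an arbitrary set S, dim S is the dimension of span S. *)
definition lattice_subspace :: "nat \<Rightarrow> (real ^ 'n) set \<Rightarrow> bool" where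
  "lattice_subspace k L \<longleftrightarrow> subspace L \<and> dim L = k \<and> dim (L \<inter> int_lattice) = k"

end

(* Let M be the lattice of integer points of L. Two integer points of K in t + L whose difference
   lies in 2M have half their difference in K and M, because K is convex and symmetric. Hence each
   class modulo 2M contains at most #(K \<inter> L) points, and it remains to see that M / 2M has at
   most 2^k elements. As L is a subspace, M / 2M embeds into (Z/2)^n, that is, a class is
   determined by its pattern of odd coordinates. The patterns are counted by induction on dim L,
   splitting off a vector v of M with minimal positive i-th coordinate: every element of M is an
   integer multiple of v plus an element of M with vanishing i-th coordinate.

   For sharpness take L spanned by k coordinate axes, e a further unit vector, and for K the convex
   hull of e + [0,1]^k and its negative: the slice of K in L is [-1/2,1/2]^k. *)
theory Submission
  imports Defs
begin

section \<open>Integer points of bounded sets\<close>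

lemma subgroup_int_lattice:
  assumes "x \<in> int_lattice" "y \<in> int_lattice"
  shows "x + y \<in> int_lattice" "x - y \<in> int_lattice"
  using assms by (auto simp: int_lattice_def)

lemma scaleR_int_lattice:
  assumes "x \<in> int_lattice"
  shows "of_int m *\<^sub>R x \<in> int_lattice"
  using assms by (auto simp: int_lattice_def)

text \<open>Ensures that \<open>num_int_points\<close> is a genuine count on bounded sets, where
  \<open>card\<close> does not fall back to 0.\<close>

lemma finite_bounded_int_lattice:
  fixes M :: "(real ^ 'n::finite) set"
  assumes "bounded M"
  shows "finite (M \<inter> int_lattice)"
proof -
  obtain B where B: "\<And>x. x \<in> M \<Longrightarrow> norm x \<le> B"
    using assms by (auto simp: bounded_iff)
  let ?N = "\<lceil>B\<rceil>"
  have "finite {f :: 'n \<Rightarrow> int. range f \<subseteq> {-?N..?N}}"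
    using finite_PiE[of "UNIV :: 'n set" "\<lambda>_. {-?N..?N}"]
    by (simp add: PiE_def Pi_def image_subset_iff)
  moreover have "M \<inter> int_lattice \<subseteq>
      (\<lambda>f. \<chi> i. of_int (f i)) ` {f :: 'n \<Rightarrow> int. range f \<subseteq> {-?N..?N}}"
  proof
    fix x assume x: "x \<in> M \<inter> int_lattice"
    have "\<lfloor>x $ i\<rfloor> \<in> {-?N..?N}" for i
    proof -
      have "\<bar>x $ i\<bar> \<le> B"
        using B[of x] x component_le_norm_cart[of x i] by auto
      moreover have "real_of_int \<lfloor>x $ i\<rfloor> = x $ i"
        using x by (auto simp: int_lattice_def)
      ultimately have "\<bar>real_of_int \<lfloor>x $ i\<rfloor>\<bar> \<le> of_int ?N"
        by linarith
      then show ?thesis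
        by (auto simp: abs_le_iff)
    qed
    moreover have "x = (\<chi> i. of_int \<lfloor>x $ i\<rfloor>)"
      using x by (auto simp: int_lattice_def vec_eq_iff)
    ultimately show "x \<in> (\<lambda>f. \<chi> i. of_int (f i)) ` {f :: 'n \<Rightarrow> int. range f \<subseteq> {-?N..?N}}"
      by (intro image_eqI[where x = "\<lambda>i. \<lfloor>x $ i\<rfloor>"]) auto
  qed
  ultimately show ?thesis
    by (meson finite_imageI finite_subset)
qed

section \<open>Parity classes of integer points\<close>

text \<open>On integer vectors this is reduction modulo 2: an element of (Z/2)^n is encoded as the
  set of its nonzero coordinates, so that addition becomes \<open>sym_diff\<close>.\<close>

definition odd_coords :: "real ^ 'n \<Rightarrow> 'n set" where
  "odd_coords x = {i. odd \<lfloor>x $ i\<rfloor>}"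

lemma odd_coords_add_multiple:
  assumes "v \<in> int_lattice"
  shows "odd_coords (x + of_int m *\<^sub>R v) =
    (if even m then odd_coords x else sym_diff (odd_coords x) (odd_coords v))"
proof -
  have "\<lfloor>(x + of_int m *\<^sub>R v) $ i\<rfloor> = \<lfloor>x $ i\<rfloor> + m * \<lfloor>v $ i\<rfloor>" for i
  proof -
    obtain z where z: "v $ i = of_int z"
      using assms by (auto simp: int_lattice_def elim: Ints_cases)
    then have "(x + of_int m *\<^sub>R v) $ i = x $ i + of_int (m * z)"
      by simp
    then show ?thesis
      using z by (simp only: floor_add_int[symmetric] floor_of_int)
  qed
  then show ?thesis
    by (auto simp: odd_coords_def)
qed

text \<open>The kernel of reduction modulo 2 on Z^n is 2 Z^n.\<close>

lemma half_diff_int_lattice: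
  assumes "x \<in> int_lattice" "y \<in> int_lattice" "odd_coords x = odd_coords y"
  shows "(1/2) *\<^sub>R (x - y) \<in> int_lattice"
  unfolding int_lattice_def
proof (intro CollectI allI)
  fix i
  obtain a b where ab: "x $ i = of_int a" "y $ i = of_int b"
    using assms by (auto simp: int_lattice_def elim!: Ints_cases dest!: spec[of _ i])
  have "i \<in> odd_coords x \<longleftrightarrow> i \<in> odd_coords y"
    using assms(3) by simp
  then have "even (a - b)"
    by (simp add: odd_coords_def ab)
  then obtain m where "a - b = 2 * m" ..
  then have "x $ i - y $ i = of_int (2 * m)"
    using ab by (metis of_int_diff)
  then show "((1/2) *\<^sub>R (x - y)) $ i \<in> \<int>"
    by simp
qed

text \<open>Splitting off one lattice vector \<open>v\<close> lowers the dimension and at most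
  doubles the number of patterns, since a multiple of \<open>v\<close> contributes either nothing or
  the pattern of \<open>v\<close>.\<close>

lemma card_odd_coords_le:
  fixes L :: "(real ^ 'n::finite) set"
  assumes "subspace L"
  shows "card (odd_coords ` (L \<inter> int_lattice)) \<le> 2 ^ dim L"
  using assms
proof (induction "dim L" arbitrary: L rule: less_induct)
  case less
  show ?case
  proof (cases "L \<inter> int_lattice \<subseteq> {0}")
    \<comment> \<open>This covers dimension 0 and also subspaces of positive dimension that meet Z^n
      only in the origin.\<close>
    case True
    then have "card (odd_coords ` (L \<inter> int_lattice)) \<le> card {odd_coords (0 :: real ^ 'n)}"
      by (intro card_mono) auto
    also have "\<dots> \<le> 2 ^ dim L"
      by simp
    finally show ?thesis .
  next
    case False
    then obtain x where "x \<in> L" "x \<in> int_lattice" "x \<noteq> 0"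
      by blast
    then obtain i where x: "x \<in> L" "x \<in> int_lattice" "x $ i \<noteq> 0"
      by (auto simp: vec_eq_iff)
    \<comment> \<open>The positive i-th coordinates of lattice vectors are recorded as natural
      numbers, so that a least one exists.\<close>
    define P where "P d \<longleftrightarrow> 0 < d \<and> (\<exists>v \<in> L \<inter> int_lattice. v $ i = real d)" for d :: nat
    have "\<exists>d. P d"
    proof -
      obtain z where z: "x $ i = of_int z"
        using x(2) by (auto simp: int_lattice_def elim: Ints_cases)
      have "of_int (sgn z) *\<^sub>R x \<in> L \<inter> int_lattice"
        using x less.prems by (intro IntI subspace_scale scaleR_int_lattice)
      moreover have "(of_int (sgn z) *\<^sub>R x) $ i = real (nat \<bar>z\<bar>)"
        using z by (simp add: sgn_if)
      moreover have "0 < nat \<bar>z\<bar>"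
        using x z by auto
      ultimately show ?thesis
        unfolding P_def by blast
    qed
    define d where "d = (LEAST d. P d)"
    have "P d"
      unfolding d_def by (rule LeastI_ex) fact
    then obtain v where v: "v \<in> L" "v \<in> int_lattice" "v $ i = real d" and d: "0 < d"
      by (auto simp: P_def)
    define L' where "L' = L \<inter> {x. x $ i = 0}"
    have L': "subspace L'"
      unfolding L'_def using less.prems
      by (intro subspace_inter) (auto simp: subspace_def)
    have "dim L' < dim L"
    proof (rule dim_psubset)
      have "L' \<subset> L"
        using x by (auto simp: L'_def)
      then show "span L' \<subset> span L"
        using L' less.prems by (simp add: span_eq_iff[THEN iffD2])
    qed
    let ?C = "odd_coords ` (L' \<inter> int_lattice)"
    have IH: "card ?C \<le> 2 ^ dim L'"
      using less.hyps \<open>dim L' < dim L\<close> L' by blast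
    have "odd_coords ` (L \<inter> int_lattice) \<subseteq> ?C \<union> (\<lambda>S. sym_diff S (odd_coords v)) ` ?C"
    proof
      fix S assume "S \<in> odd_coords ` (L \<inter> int_lattice)"
      then obtain s where s: "s \<in> L" "s \<in> int_lattice" "S = odd_coords s"
        by auto
      obtain z where z: "s $ i = of_int z"
        using s(2) by (auto simp: int_lattice_def elim: Ints_cases)
      \<comment> \<open>Euclidean division: the i-th coordinate of \<open>w\<close> is the remainder
        \<open>z mod int d\<close>, which is below \<open>d\<close> and hence 0 by minimality of
        \<open>d\<close>.\<close>
      define m where "m = z div int d"
      define w where "w = s - of_int m *\<^sub>R v"
      have w: "w \<in> L" "w \<in> int_lattice"
        using s v less.prems unfolding w_def
        by (auto intro: subspace_diff subspace_scale subgroup_int_lattice scaleR_int_lattice)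
      have "w $ i = of_int (z - m * int d)"
        using z v by (simp add: w_def)
      also have "z - m * int d = z mod int d"
        by (simp add: m_def minus_div_mult_eq_mod)
      finally have wi: "w $ i = real (nat (z mod int d))"
        using d by simp
      have "nat (z mod int d) < d"
        using d by (simp add: nat_less_iff)
      then have "\<not> P (nat (z mod int d))"
        unfolding d_def by (rule not_less_Least)
      then have "w $ i = 0"
        using wi w unfolding P_def by (metis IntI gr0I of_nat_0)
      then have "w \<in> L' \<inter> int_lattice"
        using w by (auto simp: L'_def)
      moreover have "s = w + of_int m *\<^sub>R v"
        by (simp add: w_def)
      then have "S = odd_coords w \<or> S = sym_diff (odd_coords w) (odd_coords v)"
        using s odd_coords_add_multiple[OF v(2), of w m] by metis
      ultimately show "S \<in> ?C \<union> (\<lambda>S. sym_diff S (odd_coords v)) ` ?C"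
        by blast
    qed
    then have "card (odd_coords ` (L \<inter> int_lattice)) \<le>
        card (?C \<union> (\<lambda>S. sym_diff S (odd_coords v)) ` ?C)"
      by (intro card_mono) auto
    also have "\<dots> \<le> card ?C + card ?C"
      by (intro order_trans[OF card_Un_le] add_mono card_image_le) auto
    also have "\<dots> \<le> 2 ^ Suc (dim L')"
      using IH by simp
    also have "\<dots> \<le> 2 ^ dim L"
      using \<open>dim L' < dim L\<close> by (intro power_increasing) auto
    finally show ?thesis .
  qed
qed

section \<open>The upper bound\<close>

lemma num_int_points_translate_le:
  fixes K L :: "(real ^ 'n::finite) set"
  assumes K: "convex_body K" "origin_symmetric K" and L: "subspace L"
  shows "num_int_points (K \<inter> (\<lambda>x. t + x) ` L) \<le> 2 ^ dim L * num_int_points (K \<inter> L)"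
proof (cases "K \<inter> (\<lambda>x. t + x) ` L \<inter> int_lattice = {}")
  case True
  then show ?thesis
    by (simp add: num_int_points_def)
next
  case False
  define A where "A = K \<inter> (\<lambda>x. t + x) ` L \<inter> int_lattice"
  obtain a where a: "a \<in> A"
    using False by (auto simp: A_def)
  \<comment> \<open>Since \<open>t\<close> need not be integral, classes are taken relative to a
    base point \<open>a\<close> of the slice: \<open>x - a\<close> is an integer point of
    \<open>L\<close>, so every value of \<open>q\<close> is one of the patterns counted
    above.\<close>
  define q where "q x = odd_coords (x - a)" for x
  have "bounded K"
    using K by (auto simp: convex_body_def compact_imp_bounded)
  then have fin: "finite (K \<inter> L \<inter> int_lattice)"
    by (intro finite_bounded_int_lattice) (auto intro: bounded_subset)
  have diff: "x - y \<in> L" if xy: "x \<in> A" "y \<in> A" for x y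
  proof -
    obtain u w where "x = t + u" "y = t + w" "u \<in> L" "w \<in> L"
      using xy unfolding A_def by blast
    then show ?thesis
      using subspace_diff[OF L, of u w] by simp
  qed
  have fibre: "card {x \<in> A. q x = c} \<le> num_int_points (K \<inter> L)" for c
  proof (cases "{x \<in> A. q x = c} = {}")
    case True
    then show ?thesis
      by (simp only: True card.empty le0)
  next
    case False
    then obtain y where y: "y \<in> A" "q y = c"
      by auto
    show ?thesis
      unfolding num_int_points_def
    proof (rule card_inj_on_le[OF _ _ fin])
      \<comment> \<open>With \<open>y\<close> fixed, x is sent to the midpoint of x and -y, which
        embeds the whole class into the central slice.\<close>
      show "inj_on (\<lambda>x. (1/2) *\<^sub>R (x - y)) {x \<in> A. q x = c}"
        by (auto simp: inj_on_def)
      show "(\<lambda>x. (1/2) *\<^sub>R (x - y)) ` {x \<in> A. q x = c} \<subseteq> K \<inter> L \<inter> int_lattice"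
      proof safe
        fix x assume x: "x \<in> A" "c = q x"
        have "- y \<in> K"
          using K(2) y by (auto simp: A_def origin_symmetric_def)
        then have "(1/2) *\<^sub>R x + (1/2) *\<^sub>R (- y) \<in> K"
          using K(1) x by (intro convexD) (auto simp: convex_body_def A_def)
        then show "(1/2) *\<^sub>R (x - y) \<in> K"
          by (simp add: scaleR_diff_right)
        show "(1/2) *\<^sub>R (x - y) \<in> L"
          using diff x y L by (intro subspace_scale) auto
        have "(1/2) *\<^sub>R ((x - a) - (y - a)) \<in> int_lattice"
          using x y a by (intro half_diff_int_lattice)
            (auto simp: A_def q_def intro: subgroup_int_lattice)
        then show "(1/2) *\<^sub>R (x - y) \<in> int_lattice"
          by simp
      qed
    qed
  qed
  let ?C = "odd_coords ` (L \<inter> int_lattice)"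
  have "A = (\<Union>c \<in> ?C. {x \<in> A. q x = c})"
    using a diff by (auto simp: q_def A_def intro: subgroup_int_lattice)
  then have "card A = card (\<Union>c \<in> ?C. {x \<in> A. q x = c})"
    by (rule arg_cong)
  also have "\<dots> \<le> (\<Sum>c \<in> ?C. card {x \<in> A. q x = c})"
    by (intro card_UN_le) simp
  also have "\<dots> \<le> card ?C * num_int_points (K \<inter> L)"
    using sum_bounded_above[of ?C "\<lambda>c. card {x \<in> A. q x = c}"] fibre by auto
  also have "\<dots> \<le> 2 ^ dim L * num_int_points (K \<inter> L)"
    using card_odd_coords_le[OF L] by simp
  finally show ?thesis
    by (simp add: A_def num_int_points_def)
qed

section \<open>Sharpness of the constant\<close>

text \<open>The unit vectors indexed by \<open>J\<close> are integral and independent, which bounds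
  the dimension of the integer points from below; the subspace itself bounds it from above.\<close>

lemma lattice_subspace_coordinate:
  fixes J :: "'n::finite set"
  shows "lattice_subspace (card J) {x :: real ^ 'n. \<forall>i. i \<notin> J \<longrightarrow> x $ i = 0}"
proof -
  let ?L = "{x :: real ^ 'n. \<forall>i. i \<notin> J \<longrightarrow> x $ i = 0}"
  let ?E = "(\<lambda>i. axis i 1 :: real ^ 'n) ` J"
  have "inj_on (\<lambda>i. axis i 1 :: real ^ 'n) J"
    by (auto simp: inj_on_def axis_eq_axis)
  then have "card ?E = card J"
    by (rule card_image)
  moreover have "independent ?E"
    by (rule independent_mono[OF independent_Basis]) (auto simp: Basis_vec_def)
  moreover have "?E \<subseteq> ?L \<inter> int_lattice"
    by (auto simp: int_lattice_def axis_def)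
  ultimately have "card J \<le> dim (?L \<inter> int_lattice)"
    using independent_card_le_dim[of ?E "?L \<inter> int_lattice"] by simp
  moreover have "dim ?L = card J"
    using dim_substandard_cart[of J, where 'a = real] by (simp only: dim_vec_eq)
  moreover have "dim (?L \<inter> int_lattice) \<le> dim ?L"
    by (intro dim_subset) auto
  moreover have "subspace ?L"
    by (auto simp: subspace_def)
  ultimately show ?thesis
    by (simp add: lattice_subspace_def)
qed

lemma translate_bound_attained:
  assumes "k < CARD('n::finite)"
  obtains K L :: "(real ^ 'n) set" and t
  where "convex_body K" "origin_symmetric K" "lattice_subspace k L"
    "num_int_points (K \<inter> L) = 1" "2 ^ k \<le> num_int_points (K \<inter> (\<lambda>x. t + x) ` L)"
proof -
  obtain J :: "'n set" where J: "card J = k"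
    using obtain_subset_with_card_n[of k "UNIV :: 'n set"] assms by auto
  \<comment> \<open>Here k < n enters: it leaves a coordinate direction outside \<open>L\<close>
    along which to translate.\<close>
  then obtain j where j: "j \<notin> J"
    using assms by (metis UNIV_eq_I less_irrefl)
  define L where "L = {x :: real ^ 'n. \<forall>i. i \<notin> J \<longrightarrow> x $ i = 0}"
  \<comment> \<open>A shear that turns the convex hull into a box. At height \<open>x $ j\<close> =
    s the \<open>J\<close>-coordinates of \<open>K\<close> fill [-1/2,1/2]^k shifted by s/2 in each
    coordinate: the cube [-1/2,1/2]^k for s = 0 and [0,1]^k for s = 1.\<close>
  define T :: "real ^ 'n \<Rightarrow> real ^ 'n" where
    "T x = (\<chi> i. if i \<in> J then x $ i - x $ j / 2 else x $ i)" for x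
  \<comment> \<open>The zero entries make the box degenerate in all directions outside
    \<open>J\<close> and \<open>j\<close>.\<close>
  define u :: "real ^ 'n" where
    "u = (\<chi> i. if i \<in> J then 1/2 else if i = j then 1 else 0)"
  define K where "K = T -` cbox (- u) u"
  have K_iff: "x \<in> K \<longleftrightarrow> (\<forall>i \<in> J. \<bar>x $ i - x $ j / 2\<bar> \<le> 1/2) \<and> \<bar>x $ j\<bar> \<le> 1 \<and>
      (\<forall>i. i \<notin> J \<longrightarrow> i \<noteq> j \<longrightarrow> x $ i = 0)" (is "_ \<longleftrightarrow> ?rhs") for x
  proof -
    have "x \<in> K \<longleftrightarrow> (\<forall>i. \<bar>T x $ i\<bar> \<le> u $ i)"
      by (auto simp: K_def mem_box_cart abs_le_iff minus_le_iff)
    also have "\<dots> \<longleftrightarrow> (\<forall>i. if i \<in> J then \<bar>x $ i - x $ j / 2\<bar> \<le> 1/2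
        else if i = j then \<bar>x $ j\<bar> \<le> 1 else x $ i = 0)"
      by (intro all_cong1) (simp add: T_def u_def)
    also have "\<dots> \<longleftrightarrow> ?rhs"
      using j by (auto split: if_split_asm)
    finally show ?thesis .
  qed
  have "linear T"
    by (rule linearI) (auto simp: T_def vec_eq_iff field_simps)
  have "bounded K"
  proof -
    \<comment> \<open>For i in \<open>J\<close>, the absolute value of \<open>x $ i\<close> is at
      most 1/2 plus half that of \<open>x $ j\<close>, hence at most 1.\<close>
    have "K \<subseteq> cbox (\<chi> i. -1) (\<chi> i. 1)"
    proof
      fix x assume x: "x \<in> K"
      have "-1 \<le> x $ i \<and> x $ i \<le> 1" for i
      proof (cases "i \<in> J \<or> i = j")
        case True
        have "\<bar>x $ j\<bar> \<le> 1" "i \<in> J \<Longrightarrow> \<bar>x $ i - x $ j / 2\<bar> \<le> 1/2"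
          using x by (auto simp: K_iff)
        with True show ?thesis by (auto simp: abs_le_iff field_simps)
      next
        case False
        then show ?thesis using x by (auto simp: K_iff)
      qed
      then show "x \<in> cbox (\<chi> i. -1) (\<chi> i. 1)"
        by (simp add: mem_box_cart)
    qed
    then show ?thesis
      using bounded_cbox bounded_subset by blast
  qed
  moreover have "closed K"
    unfolding K_def using \<open>linear T\<close>
    by (intro closed_vimage closed_cbox linear_continuous_on linear_conv_bounded_linear[THEN iffD1])
  moreover have "convex K"
    unfolding K_def using \<open>linear T\<close> by (intro convex_linear_vimage) auto
  ultimately have "convex_body K"
    by (simp add: convex_body_def compact_eq_bounded_closed)
  moreover have "origin_symmetric K"
  proof -
    have neg: "- x \<in> K" if "x \<in> K" for x
      using that by (auto simp: K_iff abs_minus_commute)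
    show ?thesis
      unfolding origin_symmetric_def
    proof
      show "K \<subseteq> uminus ` K"
        using neg by (metis image_eqI minus_minus subsetI)
    qed (use neg in blast)
  qed
  moreover have "lattice_subspace k L"
    unfolding L_def using lattice_subspace_coordinate J by blast
  moreover have "num_int_points (K \<inter> L) = 1"
  proof -
    have "x = 0" if x: "x \<in> K" "x \<in> L" "x \<in> int_lattice" for x
    proof -
      have "x $ i = 0" for i
      proof (cases "i \<in> J")
        case True
        have "x $ j = 0"
          using x j by (auto simp: L_def)
        \<comment> \<open>At height 0 the bound is 1/2, so an integral coordinate must
          vanish.\<close>
        then have "\<bar>x $ i\<bar> < 1"
          using x True by (fastforce simp: K_iff)
        moreover have "x $ i \<in> \<int>"
          using x by (auto simp: int_lattice_def)
        ultimately show ?thesis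
          using Ints_nonzero_abs_less1 by blast
      qed (use x in \<open>auto simp: L_def\<close>)
      then show ?thesis
        by (simp add: vec_eq_iff)
    qed
    moreover have "0 \<in> K \<inter> L \<inter> int_lattice"
      by (auto simp: K_iff L_def int_lattice_def)
    ultimately have "K \<inter> L \<inter> int_lattice = {0}"
      by blast
    then show ?thesis
      by (simp add: num_int_points_def)
  qed
  moreover have "2 ^ k \<le> num_int_points (K \<inter> (\<lambda>x. axis j 1 + x) ` L)"
  proof -
    \<comment> \<open>The vertices of the cube at height 1, one for each subset of \<open>J\<close>:
      these are 2^k integer points.\<close>
    define h :: "'n set \<Rightarrow> real ^ 'n" where
      "h S = axis j 1 + (\<chi> i. if i \<in> S then 1 else 0)" for S
    have h: "h S $ i = (if i = j then 1 else 0) + (if i \<in> S then 1 else 0)" for S i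
      by (simp add: h_def axis_def)
    have "card (Pow J) \<le> card (K \<inter> (\<lambda>x. axis j 1 + x) ` L \<inter> int_lattice)"
    proof (rule card_inj_on_le)
      show "inj_on h (Pow J)"
        by (auto simp: inj_on_def h_def vec_eq_iff split: if_splits; metis zero_neq_one)
      show "h ` Pow J \<subseteq> K \<inter> (\<lambda>x. axis j 1 + x) ` L \<inter> int_lattice"
      proof (intro image_subsetI IntI)
        fix S assume "S \<in> Pow J"
        then have S: "S \<subseteq> J" "j \<notin> S"
          using j by auto
        show "h S \<in> K"
          using S j by (auto simp: K_iff h)
        show "h S \<in> (\<lambda>x. axis j 1 + x) ` L"
          unfolding h_def using S by (intro imageI) (auto simp: L_def)
        show "h S \<in> int_lattice"
          by (simp add: int_lattice_def h)
      qed
      show "finite (K \<inter> (\<lambda>x. axis j 1 + x) ` L \<inter> int_lattice)"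
        using \<open>bounded K\<close> by (intro finite_bounded_int_lattice) (auto intro: bounded_subset)
    qed
    then show ?thesis
      by (simp add: card_Pow J num_int_points_def)
  qed
  ultimately show thesis
    by (rule that)
qed

theorem lemma1p3:
  fixes k :: nat
  assumes "k < CARD('n::finite)"
  shows "(\<forall>(K :: (real ^ 'n) set) L t.
            convex_body K \<and> origin_symmetric K \<and> lattice_subspace k L \<longrightarrow>
            num_int_points (K \<inter> (\<lambda>x. t + x) ` L) \<le> 2 ^ k * num_int_points (K \<inter> L))
       \<and> (\<forall>c :: real. c < 2 ^ k \<longrightarrow>
            \<not> (\<forall>(K :: (real ^ 'n) set) L t.
                  convex_body K \<and> origin_symmetric K \<and> lattice_subspace k L \<longrightarrow>
                  real (num_int_points (K \<inter> (\<lambda>x. t + x) ` L))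
                    \<le> c * real (num_int_points (K \<inter> L))))"
proof (intro conjI allI impI notI)
  fix K L :: "(real ^ 'n) set" and t
  assume "convex_body K \<and> origin_symmetric K \<and> lattice_subspace k L"
  then show "num_int_points (K \<inter> (\<lambda>x. t + x) ` L) \<le> 2 ^ k * num_int_points (K \<inter> L)"
    using num_int_points_translate_le[of K L t] by (auto simp: lattice_subspace_def)
next
  fix c :: real
  assume c: "c < 2 ^ k"
    and bound: "\<forall>(K :: (real ^ 'n) set) L t.
      convex_body K \<and> origin_symmetric K \<and> lattice_subspace k L \<longrightarrow>
      real (num_int_points (K \<inter> (\<lambda>x. t + x) ` L)) \<le> c * real (num_int_points (K \<inter> L))"
  \<comment> \<open>As the central slice of this example contains a single integer point, the
    assumed bound reduces to 2^k \<le> c.\<close>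
  obtain K L :: "(real ^ 'n) set" and t where
    "convex_body K" "origin_symmetric K" "lattice_subspace k L"
    and one: "num_int_points (K \<inter> L) = 1"
    and big: "2 ^ k \<le> num_int_points (K \<inter> (\<lambda>x. t + x) ` L)"
    using translate_bound_attained[OF assms] by metis
  then have "real (num_int_points (K \<inter> (\<lambda>x. t + x) ` L)) \<le> c * real (num_int_points (K \<inter> L))"
    using bound by blast
  moreover have "2 ^ k \<le> real (num_int_points (K \<inter> (\<lambda>x. t + x) ` L))"
    using big by (metis of_nat_le_iff of_nat_numeral of_nat_power)
  ultimately show False
    using c one by simp
qed

end
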